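(* Let $n \ge 1$ and let $p \ge q \ge r \ge 0$ be integers. Then $P_p^{q-r}P_r^{p-q} - P_q^{p-r} \in S_n$. If moreover $p \le n$, then $E_q^{p-r} - E_p^{q-r}E_r^{p-q} \in S_n$. (Here superscripts denote powers, with zeroth powers equal to $1$.)
   Context: In $\mathbb{R}[x_1,\dots,x_n]$, the normalized power sums are $P_k = \frac{1}{n}\sum_{i=1}^n x_i^k$ for integers $k \ge 0$ (so $P_0 = 1$), and the normalized elementary symmetric polynomials are $E_k = \binom{n}{k}^{-1}\sum_{1 \le i_1<\dots<i_k \le n} x_{i_1}\cdots x_{i_k}$ for integers $0 \le k \le n$ (so $E_0 = 1$). $S_n \subseteq \mathbb{R}[x_1,\dots,x_n]$ denotes the set of all polynomials of the form $\sum_{\varepsilon \in \{0,1\}^n} r_{\varepsilon} \prod_{j=1}^n x_j^{\varepsilon_j}$, where each $r_{\varepsilon}$ is a (finite) sum of squares of polynomials in $\mathbb{R}[x_1,\dots,x_n]$. Equivalently, $S_n$ is the semiring generated by the variables $x_1,\dots,x_n$ and the squares of all polynomials in $\mathbb{R}[x_1,\dots,x_n]$. *)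

theory Defs
  imports Complex_Main "HOL-Library.Poly_Mapping" "HOL-Library.FuncSet"
begin

text \<open>Polynomials with real coefficients in the variables \<open>x\<^sub>0, x\<^sub>1, \<dots>\<close> are finitely
  supported maps from monomials (themselves finitely supported exponent vectors) to coefficients;
  the product on \<open>\<Rightarrow>\<^sub>0\<close> is the convolution product.\<close>

type_synonym rmpoly = "(nat \<Rightarrow>\<^sub>0 nat) \<Rightarrow>\<^sub>0 real"

definition Cst :: "real \<Rightarrow> rmpoly"
  where "Cst c = Poly_Mapping.single 0 c"

definition X :: "nat \<Rightarrow> rmpoly"
  where "X i = Poly_Mapping.single (Poly_Mapping.single i 1) 1"

text \<open>The subring \<open>\<real>[x\<^sub>1, \<dots>, x\<^sub>n]\<close>: only the variables with index in \<open>{1..n}\<close> occur.\<close>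

definition poly_ring :: "nat \<Rightarrow> rmpoly set"
  where "poly_ring n = {f. \<forall>m \<in> Poly_Mapping.keys f. Poly_Mapping.keys m \<subseteq> {1..n}}"

definition P :: "nat \<Rightarrow> nat \<Rightarrow> rmpoly"
  where "P n k = Cst (1 / real n) * (\<Sum>i = 1..n. X i ^ k)"

definition E :: "nat \<Rightarrow> nat \<Rightarrow> rmpoly"
  where "E n k = Cst (1 / real (n choose k)) * (\<Sum>I | I \<subseteq> {1..n} \<and> card I = k. \<Prod>i\<in>I. X i)"

definition sums_of_squares :: "nat \<Rightarrow> rmpoly set"
  where "sums_of_squares n = {\<Sum>i<m. f i ^ 2 | (m :: nat) f. \<forall>i<m. f i \<in> poly_ring n}"

definition S :: "nat \<Rightarrow> rmpoly set"
  where "S n = {\<Sum>\<epsilon> \<in> {1..n} \<rightarrow>\<^sub>E {0, 1 :: nat}. s \<epsilon> * (\<Prod>j = 1..n. X j ^ \<epsilon> j) | s.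
                  \<forall>\<epsilon> \<in> {1..n} \<rightarrow>\<^sub>E {0, 1}. s \<epsilon> \<in> sums_of_squares n}"

end

theory Submission
  imports Defs
begin

text \<open>
  Since \<open>S n\<close> is closed under sums and products, inequalities modulo \<open>S n\<close> between elements of
  \<open>S n\<close> can be chained and multiplied as if the elements were nonnegative reals; only division is
  unavailable. This is why log-concavity in its usual form, \<open>E\<^sub>k\<^sup>2\<close> against the product of its two
  neighbours, is not enough: passing from it to products of distant terms requires cancelling a
  factor. The proof rests on the stronger comparisons, for \<open>m \<le> l\<close>,
  \<open>P n m * P n (l + 2) - P n (m + 1) * P n (l + 1) \<in> S n\<close> and
  \<open>E n (m + 1) * E n (l + 1) - E n m * E n (l + 2) \<in> S n\<close>
  (lemmas \<open>P_step\<close> and \<open>E_step\<close>), which never need division. From these, \<open>spread_power\<close> starts with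
  \<open>p - r\<close> copies of the index \<open>q\<close> and pushes indices apart in pairs, keeping their sum, until all
  of them have reached \<open>p\<close> or \<open>r\<close>; as the sum is kept, \<open>q - r\<close> of them end at \<open>p\<close> and \<open>p - q\<close>
  at \<open>r\<close>.

  For the power sums, the comparison symmetrises to a sum over pairs of variables \<open>x, y\<close> of
  \<open>(x y)^m (y - x) (y^k - x^k)\<close> with \<open>k = l - m + 1\<close>, and \<open>y - x\<close> divides the last factor with a
  quotient that has nonnegative coefficients.

  For the elementary symmetric polynomials, let \<open>e k\<close> be the unnormalised one of degree \<open>k\<close>, and
  \<open>e\<^sub>s k\<close> the one in all variables but \<open>X s\<close>. With \<open>i = m + 1\<close> and \<open>j = l + 1\<close>, the difference is a
  positive multiple of the sum of \<open>(X s - X t) * e\<^sub>s (i - 1) * e\<^sub>t j\<close> over all \<open>s\<close> and \<open>t\<close>. Averaging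
  with \<open>s\<close> and \<open>t\<close> exchanged turns the term of a pair \<open>s \<noteq> t\<close> into \<open>(X s - X t)^2 / 2\<close> times
  \<open>e (i - 1) * e (j - 1) - e (i - 2) * e j\<close>, taken in the remaining variables (\<open>esym_newton\<close>). That
  last factor, an unnormalised log-concavity difference, lies in \<open>S n\<close> by induction on the number
  of variables (\<open>esym_log_concave\<close>).
\<close>

section \<open>The semiring of weighted sums of squares\<close>

lemma Cst_0 [simp]: "Cst 0 = 0"
  by (simp add: Cst_def)

lemma Cst_1 [simp]: "Cst 1 = 1"
  by (simp add: Cst_def)

lemma Cst_add: "Cst (a + b) = Cst a + Cst b"
  by (simp add: Cst_def single_add)

lemma Cst_mult: "Cst (a * b) = Cst a * Cst b"
  by (simp add: Cst_def mult_single)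

lemma Cst_uminus: "Cst (- a) = - Cst a"
  by (simp add: Cst_def single_uminus)

lemma Cst_of_nat: "Cst (of_nat k) = of_nat k"
  by (induction k) (simp_all add: Cst_add)

lemma Cst_of_int: "Cst (of_int k) = of_int k"
proof (cases k)
  case (nonneg m)
  then show ?thesis by (simp add: Cst_of_nat)
next
  case (neg m)
  then show ?thesis using Cst_of_nat[of "Suc m"] by (simp add: Cst_uminus del: of_nat_Suc)
qed

lemma poly_ring_Cst: "Cst c \<in> poly_ring n"
  by (auto simp: poly_ring_def Cst_def)

lemma poly_ring_X: "i \<in> {1..n} \<Longrightarrow> X i \<in> poly_ring n"
  by (auto simp: poly_ring_def X_def)

lemma poly_ring_uminus: "f \<in> poly_ring n \<Longrightarrow> - f \<in> poly_ring n"
  by (simp add: poly_ring_def)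

lemma poly_ring_add: "f \<in> poly_ring n \<Longrightarrow> g \<in> poly_ring n \<Longrightarrow> f + g \<in> poly_ring n"
  using Poly_Mapping.keys_add[of f g] by (auto simp: poly_ring_def)

lemma poly_ring_diff: "f \<in> poly_ring n \<Longrightarrow> g \<in> poly_ring n \<Longrightarrow> f - g \<in> poly_ring n"
  using poly_ring_add[of f n "- g"] poly_ring_uminus by simp

lemma poly_ring_mult:
  assumes "f \<in> poly_ring n" "g \<in> poly_ring n"
  shows "f * g \<in> poly_ring n"
  unfolding poly_ring_def
proof (intro CollectI ballI)
  fix m assume "m \<in> Poly_Mapping.keys (f * g)"
  then obtain a b where ab: "m = a + b" "a \<in> Poly_Mapping.keys f" "b \<in> Poly_Mapping.keys g"
    using keys_mult[of f g] by blast
  have "Poly_Mapping.keys m \<subseteq> Poly_Mapping.keys a \<union> Poly_Mapping.keys b"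
    using ab(1) Poly_Mapping.keys_add by simp
  then show "Poly_Mapping.keys m \<subseteq> {1..n}"
    using ab assms by (auto simp: poly_ring_def)
qed

lemma sums_of_squares_0: "0 \<in> sums_of_squares n"
  unfolding sums_of_squares_def by (auto intro!: exI[of _ "0::nat"])

lemma sums_of_squares_add_square:
  assumes "f \<in> sums_of_squares n" "g \<in> poly_ring n"
  shows "f + g ^ 2 \<in> sums_of_squares n"
proof -
  obtain m h where h: "f = (\<Sum>i<(m::nat). h i ^ 2)" "\<forall>i<m. h i \<in> poly_ring n"
    using assms(1) by (auto simp: sums_of_squares_def)
  have "f + g ^ 2 = (\<Sum>i<Suc m. (h(m := g)) i ^ 2)"
    by (simp add: h(1))
  moreover have "\<forall>i<Suc m. (h(m := g)) i \<in> poly_ring n"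
    using h(2) assms(2) by (auto simp: less_Suc_eq)
  ultimately show ?thesis unfolding sums_of_squares_def by blast
qed

lemma sums_of_squares_induct [consumes 1, case_names zero add]:
  assumes "f \<in> sums_of_squares n"
    and "Q 0"
    and "\<And>f g. Q f \<Longrightarrow> g \<in> poly_ring n \<Longrightarrow> Q (f + g ^ 2)"
  shows "Q f"
proof -
  obtain m h where h: "f = (\<Sum>i<(m::nat). h i ^ 2)" "\<forall>i<m. h i \<in> poly_ring n"
    using assms(1) by (auto simp: sums_of_squares_def)
  have "k \<le> m \<Longrightarrow> Q (\<Sum>i<k. h i ^ 2)" for k
    by (induction k) (use assms(2,3) h(2) in auto)
  then show ?thesis using h(1) by simp
qed

lemma sums_of_squares_square: "g \<in> poly_ring n \<Longrightarrow> g ^ 2 \<in> sums_of_squares n"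
  using sums_of_squares_add_square[OF sums_of_squares_0] by simp

lemma sums_of_squares_add:
  assumes "g \<in> sums_of_squares n" "f \<in> sums_of_squares n"
  shows "f + g \<in> sums_of_squares n"
  using assms(1)
proof (induction rule: sums_of_squares_induct)
  case zero
  then show ?case using assms(2) by simp
next
  case (add g h)
  then show ?case using sums_of_squares_add_square[of "f + g" n h] by (simp add: add.assoc)
qed

lemma sums_of_squares_mult_square:
  assumes "f \<in> sums_of_squares n" "h \<in> poly_ring n"
  shows "f * h ^ 2 \<in> sums_of_squares n"
  using assms(1)
proof (induction rule: sums_of_squares_induct)
  case zero
  then show ?case by (simp add: sums_of_squares_0)
next
  case (add f g)
  then have "f * h ^ 2 + (g * h) ^ 2 \<in> sums_of_squares n"
    using assms(2) by (intro sums_of_squares_add_square poly_ring_mult)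
  then show ?case by (simp add: power_mult_distrib distrib_right)
qed

lemma sums_of_squares_mult:
  assumes "g \<in> sums_of_squares n" "f \<in> sums_of_squares n"
  shows "f * g \<in> sums_of_squares n"
  using assms(1)
proof (induction rule: sums_of_squares_induct)
  case zero
  then show ?case by (simp add: sums_of_squares_0)
next
  case (add g h)
  then show ?case
    using sums_of_squares_add[OF sums_of_squares_mult_square[OF assms(2), of h] add.IH]
    by (simp add: distrib_left)
qed

lemma S_I:
  assumes "\<And>\<epsilon>. \<epsilon> \<in> {1..n} \<rightarrow>\<^sub>E {0, 1} \<Longrightarrow> s \<epsilon> \<in> sums_of_squares n"
    and "f = (\<Sum>\<epsilon> \<in> {1..n} \<rightarrow>\<^sub>E {0, 1 :: nat}. s \<epsilon> * (\<Prod>j = 1..n. X j ^ \<epsilon> j))"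
  shows "f \<in> S n"
  unfolding S_def using assms by (intro CollectI exI[of _ s] conjI ballI)

lemma S_0: "0 \<in> S n"
  by (rule S_I[of n "\<lambda>_. 0"]) (simp_all add: sums_of_squares_0)

lemma S_add:
  assumes "f \<in> S n" "g \<in> S n"
  shows "f + g \<in> S n"
proof -
  let ?D = "{1..n} \<rightarrow>\<^sub>E {0, 1 :: nat}"
  let ?M = "\<lambda>\<epsilon> :: nat \<Rightarrow> nat. \<Prod>j = 1..n. X j ^ \<epsilon> j"
  obtain s t where s: "f = (\<Sum>\<epsilon>\<in>?D. s \<epsilon> * ?M \<epsilon>)" "\<forall>\<epsilon>\<in>?D. s \<epsilon> \<in> sums_of_squares n"
    and t: "g = (\<Sum>\<epsilon>\<in>?D. t \<epsilon> * ?M \<epsilon>)" "\<forall>\<epsilon>\<in>?D. t \<epsilon> \<in> sums_of_squares n"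
    using assms unfolding S_def by blast
  have "f + g = (\<Sum>\<epsilon>\<in>?D. (s \<epsilon> + t \<epsilon>) * ?M \<epsilon>)"
    by (simp add: s(1) t(1) distrib_right sum.distrib)
  moreover have "s \<epsilon> + t \<epsilon> \<in> sums_of_squares n" if "\<epsilon> \<in> ?D" for \<epsilon>
    using s(2) t(2) that by (auto intro: sums_of_squares_add)
  ultimately show ?thesis by (intro S_I)
qed

lemma S_sum: "(\<And>i. i \<in> A \<Longrightarrow> f i \<in> S n) \<Longrightarrow> sum f A \<in> S n"
  by (induction A rule: infinite_finite_induct) (auto intro: S_0 S_add)

lemma S_generator:
  assumes "\<sigma> \<in> sums_of_squares n" "\<epsilon> \<in> {1..n} \<rightarrow>\<^sub>E {0, 1 :: nat}"
  shows "\<sigma> * (\<Prod>j = 1..n. X j ^ \<epsilon> j) \<in> S n"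
proof -
  let ?D = "{1..n} \<rightarrow>\<^sub>E {0, 1 :: nat}"
  let ?M = "\<lambda>\<epsilon> :: nat \<Rightarrow> nat. \<Prod>j = 1..n. X j ^ \<epsilon> j"
  let ?s = "\<lambda>\<delta>. if \<delta> = \<epsilon> then \<sigma> else 0"
  have "(\<Sum>\<delta>\<in>?D. ?s \<delta> * ?M \<delta>) = (\<Sum>\<delta>\<in>?D. if \<delta> = \<epsilon> then \<sigma> * ?M \<epsilon> else 0)"
    by (intro sum.cong) auto
  also have "\<dots> = \<sigma> * ?M \<epsilon>"
    using assms(2) by (simp add: finite_PiE)
  finally have "\<sigma> * ?M \<epsilon> = (\<Sum>\<delta>\<in>?D. ?s \<delta> * ?M \<delta>)" ..
  moreover have "?s \<delta> \<in> sums_of_squares n" for \<delta>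
    using assms(1) by (simp add: sums_of_squares_0)
  ultimately show ?thesis by (intro S_I[of n ?s])
qed

lemma S_induct [consumes 1, case_names zero add generator]:
  assumes "f \<in> S n"
    and "Q 0"
    and "\<And>f g. Q f \<Longrightarrow> Q g \<Longrightarrow> Q (f + g)"
    and "\<And>\<sigma> \<epsilon>. \<sigma> \<in> sums_of_squares n \<Longrightarrow> \<epsilon> \<in> {1..n} \<rightarrow>\<^sub>E {0, 1 :: nat} \<Longrightarrow>
           Q (\<sigma> * (\<Prod>j = 1..n. X j ^ \<epsilon> j))"
  shows "Q f"
proof -
  let ?D = "{1..n} \<rightarrow>\<^sub>E {0, 1 :: nat}"
  let ?M = "\<lambda>\<epsilon> :: nat \<Rightarrow> nat. \<Prod>j = 1..n. X j ^ \<epsilon> j"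
  obtain s where s: "f = (\<Sum>\<epsilon>\<in>?D. s \<epsilon> * ?M \<epsilon>)" "\<forall>\<epsilon>\<in>?D. s \<epsilon> \<in> sums_of_squares n"
    using assms(1) unfolding S_def by blast
  have "A \<subseteq> ?D \<Longrightarrow> Q (\<Sum>\<epsilon>\<in>A. s \<epsilon> * ?M \<epsilon>)" for A
  proof (induction A rule: infinite_finite_induct)
    case (insert \<epsilon> A)
    then show ?case using assms(3,4) s(2) by simp
  qed (use assms(2) in auto)
  then show ?thesis using s(1) by simp
qed

lemma S_sums_of_squares_mult:
  assumes "f \<in> S n" "\<tau> \<in> sums_of_squares n"
  shows "\<tau> * f \<in> S n"
  using assms(1)
proof (induction rule: S_induct)
  case zero
  then show ?case by (simp add: S_0)
next
  case (add f g)
  then show ?case by (simp add: distrib_left S_add)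
next
  case (generator \<sigma> \<epsilon>)
  then show ?case
    using S_generator[OF sums_of_squares_mult[OF generator(1) assms(2)] generator(2)]
    by (simp add: mult.assoc)
qed

text \<open>Multiplying by a variable flips one bit of the exponent vector: an exponent \<open>2\<close> that arises
  is a square and is absorbed into the sum-of-squares coefficient.\<close>

lemma S_X_mult:
  assumes "f \<in> S n" and i: "i \<in> {1..n}"
  shows "X i * f \<in> S n"
  using assms(1)
proof (induction rule: S_induct)
  case zero
  then show ?case by (simp add: S_0)
next
  case (add f g)
  then show ?case by (simp add: distrib_left S_add)
next
  case (generator \<sigma> \<epsilon>)
  define \<delta> where "\<delta> = \<epsilon>(i := 1 - \<epsilon> i)"
  define \<tau> where "\<tau> = (if \<epsilon> i = 0 then \<sigma> else \<sigma> * X i ^ 2)"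
  have \<delta>: "\<delta> \<in> {1..n} \<rightarrow>\<^sub>E {0, 1}"
    using generator(2) i by (auto simp: \<delta>_def PiE_iff extensional_def)
  have \<tau>: "\<tau> \<in> sums_of_squares n"
    using generator(1) i by (simp add: \<tau>_def sums_of_squares_mult_square poly_ring_X)
  have split: "(\<Prod>j = 1..n. X j ^ \<phi> j) = X i ^ \<phi> i * (\<Prod>j \<in> {1..n} - {i}. X j ^ \<phi> j)"
    for \<phi> :: "nat \<Rightarrow> nat"
    using i by (simp add: prod.remove)
  have rest: "(\<Prod>j \<in> {1..n} - {i}. X j ^ \<delta> j) = (\<Prod>j \<in> {1..n} - {i}. X j ^ \<epsilon> j)"
    by (intro prod.cong) (auto simp: \<delta>_def)
  have "\<epsilon> i = 0 \<or> \<epsilon> i = 1"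
    using generator(2) i by (auto simp: PiE_iff)
  then have "X i * (\<sigma> * (\<Prod>j = 1..n. X j ^ \<epsilon> j)) = \<tau> * (\<Prod>j = 1..n. X j ^ \<delta> j)"
    unfolding split rest by (auto simp: \<delta>_def \<tau>_def power2_eq_square algebra_simps)
  then show ?case using S_generator[OF \<tau> \<delta>] by simp
qed

text \<open>A product with a generator of \<open>S n\<close> is a product with one sum of squares and with variables,
  one after the other.\<close>

lemma S_mult:
  assumes "g \<in> S n" "f \<in> S n"
  shows "g * f \<in> S n"
  using assms(1)
proof (induction rule: S_induct)
  case zero
  then show ?case by (simp add: S_0)
next
  case (add g h)
  then show ?case by (simp add: distrib_right S_add)
next
  case (generator \<sigma> \<epsilon>)
  have pow: "X j ^ k * h \<in> S n" if "h \<in> S n" "j \<in> {1..n}" for j k h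
    by (induction k) (use that in \<open>auto simp: mult.assoc intro: S_X_mult\<close>)
  have "A \<subseteq> {1..n} \<Longrightarrow> (\<Prod>j\<in>A. X j ^ \<epsilon> j) * f \<in> S n" for A
  proof (induction A rule: infinite_finite_induct)
    case (insert j A)
    then show ?case using pow[of "(\<Prod>j\<in>A. X j ^ \<epsilon> j) * f" j "\<epsilon> j"] by (simp add: mult.assoc)
  qed (use assms(2) in auto)
  then show ?case
    using S_sums_of_squares_mult[OF _ generator(1)] by (simp add: mult.assoc)
qed

lemma S_square:
  assumes "f \<in> poly_ring n"
  shows "f ^ 2 \<in> S n"
proof -
  \<comment> \<open>The generators are indexed by extensional functions, so the zero exponent vector is restricted.\<close>
  define \<epsilon> where "\<epsilon> = (\<lambda>j\<in>{1..n}. 0 :: nat)"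
  have "\<epsilon> \<in> {1..n} \<rightarrow>\<^sub>E {0, 1}" "(\<Prod>j = 1..n. X j ^ \<epsilon> j) = 1"
    by (auto simp: \<epsilon>_def)
  then show ?thesis
    using S_generator[OF sums_of_squares_square[OF assms], of \<epsilon>] by simp
qed

lemma S_Cst:
  assumes "c \<ge> 0"
  shows "Cst c \<in> S n"
proof -
  have "Cst c = Cst (sqrt c) ^ 2"
    using assms by (simp add: power2_eq_square flip: Cst_mult)
  then show ?thesis using S_square[OF poly_ring_Cst] by metis
qed

lemma S_1: "1 \<in> S n"
  using S_Cst[of 1 n] by simp

lemma S_X: "i \<in> {1..n} \<Longrightarrow> X i \<in> S n"
  using S_X_mult[OF S_1] by simp

lemma S_power: "f \<in> S n \<Longrightarrow> f ^ k \<in> S n"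
  by (induction k) (auto intro: S_1 S_mult)

lemma S_prod: "(\<And>i. i \<in> A \<Longrightarrow> f i \<in> S n) \<Longrightarrow> prod f A \<in> S n"
  by (induction A rule: infinite_finite_induct) (auto intro: S_1 S_mult)

lemma S_halve:
  assumes "f + f \<in> S n"
  shows "f \<in> S n"
proof -
  have "Cst (1 / 2) * (f + f) = (Cst (1 / 2) + Cst (1 / 2)) * f"
    by (simp add: algebra_simps)
  also have "\<dots> = f"
    by (simp flip: Cst_add)
  finally have "Cst (1 / 2) * (f + f) = f" .
  then show ?thesis using S_mult[OF S_Cst[of "1 / 2" n] assms] by (simp only:)
qed

text \<open>Both inequalities below arise as double sums whose terms only become weighted squares after
  adding the term with the two indices exchanged.\<close>

lemma S_double_sum:
  assumes "\<And>s t. s \<in> A \<Longrightarrow> t \<in> A \<Longrightarrow> F s t + F t s \<in> S n"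
  shows "(\<Sum>s\<in>A. \<Sum>t\<in>A. F s t) \<in> S n"
proof (rule S_halve)
  have "(\<Sum>s\<in>A. \<Sum>t\<in>A. F s t) + (\<Sum>s\<in>A. \<Sum>t\<in>A. F s t)
      = (\<Sum>s\<in>A. \<Sum>t\<in>A. F s t) + (\<Sum>s\<in>A. \<Sum>t\<in>A. F t s)"
    by (simp only: sum.swap[of F A A])
  also have "\<dots> = (\<Sum>s\<in>A. \<Sum>t\<in>A. F s t + F t s)"
    by (simp add: sum.distrib)
  also have "\<dots> \<in> S n"
    using assms by (intro S_sum) auto
  finally show "(\<Sum>s\<in>A. \<Sum>t\<in>A. F s t) + (\<Sum>s\<in>A. \<Sum>t\<in>A. F s t) \<in> S n" .
qed

section \<open>From adjacent pairs of indices to powers\<close>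

text \<open>The hypothesis \<open>step\<close> moves two indices apart by one each; iterating it reaches every pair
  with the same sum that encloses the given one. The relation \<open>R\<close> is kept abstract because the
  inequality for the power sums points the opposite way to the one for the elementary symmetric
  polynomials.\<close>

lemma spread_pair:
  fixes a :: "nat \<Rightarrow> 'a :: comm_monoid_mult"
  assumes refl: "\<And>x. R x x"
    and trans: "\<And>x y z. R x y \<Longrightarrow> R y z \<Longrightarrow> R x z"
    and step: "\<And>m l. m \<le> l \<Longrightarrow> l + 2 \<le> N \<Longrightarrow> R (a m * a (l + 2)) (a (m + 1) * a (l + 1))"
    and "x + y = z + w" "z \<le> x" "x \<le> w" "w \<le> N"
  shows "R (a z * a w) (a x * a y)"
proof -
  have aux: "x \<le> y \<Longrightarrow> y + k \<le> N \<Longrightarrow> k \<le> x \<Longrightarrow> R (a (x - k) * a (y + k)) (a x * a y)" for x y k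
  proof (induction k)
    case 0
    then show ?case by (simp add: refl)
  next
    case (Suc k)
    have "R (a (x - Suc k) * a (y + k - 1 + 2)) (a (x - Suc k + 1) * a (y + k - 1 + 1))"
      using Suc.prems by (intro step) auto
    moreover have "y + k - 1 + 2 = y + Suc k" "x - Suc k + 1 = x - k" "y + k - 1 + 1 = y + k"
      using Suc.prems by auto
    ultimately have "R (a (x - Suc k) * a (y + Suc k)) (a (x - k) * a (y + k))"
      by simp
    with Suc show ?case using trans by simp
  qed
  show ?thesis
  proof (cases "x \<le> y")
    case True
    moreover have "y + (x - z) = w" "x - (x - z) = z" using assms(4,5) by auto
    ultimately show ?thesis using aux[of x y "x - z"] assms(7) by simp
  next
    case False
    moreover have "x + (y - z) = w" "y - (y - z) = z" using assms(4,6) by auto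
    ultimately show ?thesis using aux[of y x "y - z"] assms(7) by (simp add: mult.commute)
  qed
qed

text \<open>The induction keeps the indices in the form \<open>c, q, \<dots>, q\<close> together with some that have already
  reached \<open>p\<close> or \<open>r\<close>. Pushing \<open>c\<close> and one \<open>q\<close> apart until the first of them hits an end of the range
  \<open>{r..p}\<close> leaves a single floating index again, with one copy of \<open>q\<close> less.\<close>

lemma spread_power:
  fixes a :: "nat \<Rightarrow> 'a :: comm_monoid_mult"
  assumes refl: "\<And>x. R x x"
    and trans: "\<And>x y z. R x y \<Longrightarrow> R y z \<Longrightarrow> R x z"
    and mult: "\<And>x y k. k \<le> N \<Longrightarrow> R x y \<Longrightarrow> R (a k * x) (a k * y)"
    and step: "\<And>m l. m \<le> l \<Longrightarrow> l + 2 \<le> N \<Longrightarrow> R (a m * a (l + 2)) (a (m + 1) * a (l + 1))"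
    and "r \<le> q" "q \<le> p" "p \<le> N"
  shows "R (a p ^ (q - r) * a r ^ (p - q)) (a q ^ (p - r))"
proof (cases "r < q \<and> q < p")
  case False
  then have "q = r \<or> q = p" using assms(5,6) by auto
  then show ?thesis by (auto simp: refl)
next
  case True
  have pair: "R (a z * a w) (a x * a y)"
    if "x + y = z + w" "z \<le> x" "x \<le> w" "w \<le> N" for x y z w
    using spread_pair[of R N a x y z w] refl trans step that by blast
  have mult_pow: "R (a k ^ g * x) (a k ^ g * y)" if "R x y" "k \<le> N" for k g x y
    by (induction g) (use that mult in \<open>auto simp: mult.assoc\<close>)
  have spread: "R (a p ^ \<alpha> * a r ^ \<beta>) (a c * a q ^ g)"
    if "r \<le> c" "c \<le> p" "\<alpha> + \<beta> = g + 1" "\<alpha> * p + \<beta> * r = c + g * q" for c \<alpha> \<beta> g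
    using that
  proof (induction g arbitrary: c \<alpha> \<beta>)
    case 0
    \<comment> \<open>The conserved sum forces the last floating index onto an end of the range.\<close>
    then have "\<alpha> = 0 \<and> \<beta> = 1 \<or> \<alpha> = 1 \<and> \<beta> = 0" by auto
    then show ?case using 0 by (auto simp: refl)
  next
    case (Suc g)
    show ?case
    proof (cases "c + q \<ge> r + p")
      case ge: True
      \<comment> \<open>One index goes up to \<open>p\<close>; since \<open>q > r\<close>, the sum is too large for all of them to end at \<open>r\<close>.\<close>
      have "\<alpha> \<noteq> 0"
      proof
        assume "\<alpha> = 0"
        then have "\<beta> = g + 2" using Suc.prems(3) by simp
        with \<open>\<alpha> = 0\<close> have "(g + 2) * r = c + Suc g * q" using Suc.prems(4) by simp
        moreover have "Suc g * r < Suc g * q" using True by (intro mult_strict_left_mono) auto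
        ultimately show False using Suc.prems(1) by simp
      qed
      then obtain \<alpha>' where \<alpha>': "\<alpha> = Suc \<alpha>'" by (cases \<alpha>) auto
      have "R (a p ^ \<alpha>' * a r ^ \<beta>) (a (c + q - p) * a q ^ g)"
        using Suc.prems ge True by (intro Suc.IH) (auto simp: \<alpha>')
      then have "R (a p ^ \<alpha> * a r ^ \<beta>) (a p * (a (c + q - p) * a q ^ g))"
        using mult[OF \<open>p \<le> N\<close>] by (simp add: \<alpha>' mult.assoc)
      moreover have "R (a q ^ g * (a (c + q - p) * a p)) (a q ^ g * (a c * a q))"
        using Suc.prems ge True assms(7) by (intro mult_pow pair) auto
      ultimately show ?thesis using trans by (simp add: ac_simps)
    next
      case lt: False
      \<comment> \<open>Dually, one index goes down to \<open>r\<close>.\<close>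
      have "\<beta> \<noteq> 0"
      proof
        assume "\<beta> = 0"
        then have "\<alpha> = g + 2" using Suc.prems(3) by simp
        with \<open>\<beta> = 0\<close> have "(g + 2) * p = c + Suc g * q" using Suc.prems(4) by simp
        moreover have "Suc g * q < Suc g * p" using True by (intro mult_strict_left_mono) auto
        ultimately show False using Suc.prems(2) by simp
      qed
      then obtain \<beta>' where \<beta>': "\<beta> = Suc \<beta>'" by (cases \<beta>) auto
      have "R (a p ^ \<alpha> * a r ^ \<beta>') (a (c + q - r) * a q ^ g)"
        using Suc.prems lt True by (intro Suc.IH) (auto simp: \<beta>')
      then have "R (a r * (a p ^ \<alpha> * a r ^ \<beta>')) (a r * (a (c + q - r) * a q ^ g))"
        using True assms(7) by (intro mult) auto
      then have "R (a p ^ \<alpha> * a r ^ \<beta>) (a r * (a (c + q - r) * a q ^ g))"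
        by (simp add: \<beta>' ac_simps)
      moreover have "R (a q ^ g * (a r * a (c + q - r))) (a q ^ g * (a c * a q))"
        using Suc.prems lt True assms(7) by (intro mult_pow pair) auto
      ultimately show ?thesis using trans by (simp add: ac_simps)
    qed
  qed
  have "(q - r) * p + (p - q) * r = q + (p - r - 1) * q"
  proof -
    obtain u v where "q = r + u" "p = r + u + Suc v"
      using True by (metis less_imp_Suc_add less_imp_le_nat le_Suc_ex add_Suc_right)
    then show ?thesis by (simp add: algebra_simps)
  qed
  then have "R (a p ^ (q - r) * a r ^ (p - q)) (a q * a q ^ (p - r - 1))"
    using True by (intro spread) auto
  moreover have "a q * a q ^ (p - r - 1) = a q ^ (p - r)"
    using True by (simp flip: power_Suc add: Suc_diff_Suc)
  ultimately show ?thesis by simp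
qed

section \<open>Power sums\<close>

lemma P_in_S: "P n k \<in> S n"
  unfolding P_def by (intro S_mult S_sum S_power S_X S_Cst) auto

lemma P_step:
  assumes "m \<le> l"
  shows "P n m * P n (l + 2) - P n (m + 1) * P n (l + 1) \<in> S n"
proof -
  obtain k where k: "l = m + k" using assms le_Suc_ex by blast
  define F where "F = (\<lambda>s t. X s ^ m * X t ^ (l + 2) - X s ^ (m + 1) * X t ^ (l + 1))"
  have sym: "F s t + F t s \<in> S n" if "s \<in> {1..n}" "t \<in> {1..n}" for s t
  proof -
    have "F s t + F t s = X s ^ m * X t ^ m * ((X t - X s) * (X t ^ Suc k - X s ^ Suc k))"
      by (simp add: F_def k power_add algebra_simps power2_eq_square)
    also have "\<dots> = X s ^ m * X t ^ m * ((X t - X s) ^ 2 * (\<Sum>i<Suc k. X s ^ (Suc k - Suc i) * X t ^ i))"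
      by (simp only: power_diff_sumr2 power2_eq_square mult.assoc)
    finally show ?thesis
      using that by (auto simp del: sum.lessThan_Suc
          intro!: S_mult S_power S_sum S_square S_X poly_ring_diff poly_ring_X)
  qed
  have "(\<Sum>s=1..n. \<Sum>t=1..n. F s t) \<in> S n"
    using sym by (rule S_double_sum)
  then have "Cst (1 / n) * Cst (1 / n) * (\<Sum>s=1..n. \<Sum>t=1..n. F s t) \<in> S n"
    by (intro S_mult S_Cst) auto
  also have "(\<Sum>s=1..n. \<Sum>t=1..n. F s t) =
      (\<Sum>s=1..n. X s ^ m) * (\<Sum>t=1..n. X t ^ (l + 2)) -
      (\<Sum>s=1..n. X s ^ (m + 1)) * (\<Sum>t=1..n. X t ^ (l + 1))"
    by (simp only: F_def sum_product sum_subtractf)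
  finally show ?thesis
    by (simp add: P_def algebra_simps)
qed

section \<open>Elementary symmetric polynomials\<close>

text \<open>The degree is an integer so that the recursion \<open>esym_insert\<close> holds in every degree, the
  polynomials of negative degree being \<open>0\<close>; the index \<open>i - 2\<close> occurs below with \<open>i = 1\<close>.\<close>

definition esym :: "('b \<Rightarrow> 'a :: comm_ring_1) \<Rightarrow> 'b set \<Rightarrow> int \<Rightarrow> 'a"
  where "esym x A k = (\<Sum>I | I \<subseteq> A \<and> int (card I) = k. \<Prod>i\<in>I. x i)"

lemma esym_empty:
  fixes x :: "'b \<Rightarrow> 'a :: comm_ring_1"
  shows "esym x {} k = (if k = 0 then 1 else 0)"
proof -
  have *: "{I :: 'b set. I \<subseteq> {} \<and> int (card I) = k} = (if k = 0 then {{}} else {})"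
    by auto
  show ?thesis unfolding esym_def * by simp
qed

lemma esym_insert:
  assumes "finite A" "a \<notin> A"
  shows "esym x (insert a A) k = esym x A k + x a * esym x A (k - 1)"
proof -
  let ?B = "{I. I \<subseteq> A \<and> int (card I) = k}" and ?C = "{I. I \<subseteq> A \<and> int (card I) = k - 1}"
  have fin: "finite I" if "I \<subseteq> A" for I using that assms(1) finite_subset by blast
  have inj: "inj_on (insert a) ?C"
    using assms(2) by (auto simp: inj_on_def)
  have split: "{I. I \<subseteq> insert a A \<and> int (card I) = k} = ?B \<union> insert a ` ?C"
  proof (intro equalityI subsetI)
    fix I assume I: "I \<in> {I. I \<subseteq> insert a A \<and> int (card I) = k}"
    show "I \<in> ?B \<union> insert a ` ?C"
    proof (cases "a \<in> I")
      case True
      have "finite I" using I assms(1) by (auto intro: finite_subset)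
      then have "int (card (I - {a})) = k - 1"
        using I True card_Suc_Diff1[of I a] by auto
      then have "I - {a} \<in> ?C" using I by auto
      moreover have "I = insert a (I - {a})" using True by auto
      ultimately show ?thesis by blast
    qed (use I in auto)
  next
    fix I assume "I \<in> ?B \<union> insert a ` ?C"
    then show "I \<in> {I. I \<subseteq> insert a A \<and> int (card I) = k}"
      using assms(2) fin by (auto simp: card_insert_if)
  qed
  have "esym x (insert a A) k = (\<Sum>I\<in>?B. \<Prod>i\<in>I. x i) + (\<Sum>I\<in>insert a ` ?C. \<Prod>i\<in>I. x i)"
    unfolding esym_def split using assms by (intro sum.union_disjoint) auto
  also have "(\<Sum>I\<in>insert a ` ?C. \<Prod>i\<in>I. x i) = (\<Sum>I\<in>?C. \<Prod>i\<in>insert a I. x i)"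
    using inj by (simp add: sum.reindex)
  also have "\<dots> = (\<Sum>I\<in>?C. x a * (\<Prod>i\<in>I. x i))"
    using assms(2) fin by (intro sum.cong refl prod.insert) auto
  finally show ?thesis by (simp add: esym_def sum_distrib_left)
qed

text \<open>A monomial of degree \<open>k\<close> survives the removal of \<open>s\<close> for exactly \<open>card A - k\<close> of the \<open>s\<close>; in the
  second identity, it is recovered as \<open>x s\<close> times a monomial free of \<open>x s\<close> for exactly \<open>k\<close> of
  the \<open>s\<close>. The recursion reduces both to linear bookkeeping.\<close>

lemma sum_esym_remove:
  assumes "finite A"
  shows "(\<Sum>s\<in>A. esym x (A - {s}) k) = of_int (int (card A) - k) * esym x A k"
  using assms
proof (induction A arbitrary: k rule: finite_induct)
  case empty
  then show ?case by (simp add: esym_empty)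
next
  case (insert a A)
  have "esym x (insert a A - {s}) k = esym x (A - {s}) k + x a * esym x (A - {s}) (k - 1)"
    if "s \<in> A" for s
  proof -
    have "insert a A - {s} = insert a (A - {s})" using insert.hyps that by auto
    then show ?thesis using insert.hyps by (simp add: esym_insert)
  qed
  then have "(\<Sum>s\<in>insert a A. esym x (insert a A - {s}) k)
      = esym x A k + (\<Sum>s\<in>A. esym x (A - {s}) k) + x a * (\<Sum>s\<in>A. esym x (A - {s}) (k - 1))"
    using insert.hyps by (simp add: sum.distrib sum_distrib_left)
  then show ?case
    using insert.hyps by (simp add: insert.IH esym_insert algebra_simps)
qed

lemma sum_mult_esym_remove:
  assumes "finite A"
  shows "(\<Sum>s\<in>A. x s * esym x (A - {s}) (k - 1)) = of_int k * esym x A k"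
  using assms
proof (induction A arbitrary: k rule: finite_induct)
  case empty
  then show ?case by (simp add: esym_empty)
next
  case (insert a A)
  have "esym x (insert a A - {s}) (k - 1)
      = esym x (A - {s}) (k - 1) + x a * esym x (A - {s}) (k - 1 - 1)"
    if "s \<in> A" for s
  proof -
    have "insert a A - {s} = insert a (A - {s})" using insert.hyps that by auto
    then show ?thesis using insert.hyps by (simp add: esym_insert)
  qed
  then have "(\<Sum>s\<in>insert a A. x s * esym x (insert a A - {s}) (k - 1))
      = x a * esym x A (k - 1) + (\<Sum>s\<in>A. x s * esym x (A - {s}) (k - 1))
        + x a * (\<Sum>s\<in>A. x s * esym x (A - {s}) (k - 1 - 1))"
    using insert.hyps by (simp add: sum.distrib sum_distrib_left algebra_simps)
  then show ?case
    using insert.hyps by (simp only: insert.IH) (simp add: esym_insert algebra_simps)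
qed

text \<open>Write \<open>e k\<close> for the polynomial of degree \<open>k\<close> in the variables \<open>A\<close>, and \<open>D i j\<close> for the difference.
  Adding a variable \<open>x\<close> turns \<open>D i j\<close> into
  \<open>D i j + x (e i * e (j - 1) - e (i - 2) * e (j + 1)) + x^2 D (i - 1) (j - 1)\<close>, and the bracket
  telescopes to \<open>D i (j - 1) + D (i - 1) j\<close>.\<close>

lemma esym_log_concave:
  assumes "A \<subseteq> {1..n}" "i \<le> j"
  shows "esym X A i * esym X A j - esym X A (i - 1) * esym X A (j + 1) \<in> S n"
proof -
  have "finite A" using assms(1) finite_subset by blast
  then show ?thesis using assms
  proof (induction A arbitrary: i j rule: finite_induct)
    case empty
    then show ?case by (auto simp: esym_empty S_0 S_1)
  next
    case (insert a A)
    let ?e = "esym X A"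
    define D where "D = (\<lambda>i j. ?e i * ?e j - ?e (i - 1) * ?e (j + 1))"
    have D: "D i j \<in> S n" if "i \<le> j" for i j
      using insert.IH insert.prems(1) that by (simp add: D_def)
    \<comment> \<open>For \<open>i = j\<close> the induction hypothesis does not apply, but then the difference vanishes.\<close>
    have "D i (j - 1) \<in> S n"
    proof (cases "i = j")
      case True
      then show ?thesis by (simp add: D_def S_0)
    next
      case False
      then show ?thesis using insert.prems(2) by (intro D) auto
    qed
    moreover have "D i j \<in> S n" "D (i - 1) j \<in> S n" "D (i - 1) (j - 1) \<in> S n"
      using insert.prems(2) by (auto intro: D)
    moreover have "X a \<in> S n"
      using insert.prems(1) by (auto intro: S_X)
    ultimately have "D i j + X a * (D i (j - 1) + D (i - 1) j) + X a ^ 2 * D (i - 1) (j - 1) \<in> S n"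
      by (intro S_add S_mult S_power)
    also have "D i j + X a * (D i (j - 1) + D (i - 1) j) + X a ^ 2 * D (i - 1) (j - 1)
        = (?e i + X a * ?e (i - 1)) * (?e j + X a * ?e (j - 1))
          - (?e (i - 1) + X a * ?e (i - 1 - 1)) * (?e (j + 1) + X a * ?e (j + 1 - 1))"
      by (simp add: D_def algebra_simps power2_eq_square)
    finally show ?case
      using insert.hyps by (simp add: esym_insert)
  qed
qed

text \<open>The coefficients are those that the normalisation by binomial coefficients absorbs. They are
  also what \<open>sum_esym_remove\<close> and \<open>sum_mult_esym_remove\<close> produce: these turn the left-hand side into
  a difference of two products of sums over removed variables, that is, the double sum of
  \<open>(X s - X t) * e\<^sub>s (i - 1) * e\<^sub>t j\<close>, where the index of \<open>e\<close> is the variable removed. It symmetrises to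
  squares weighted by log-concavity differences.\<close>

lemma esym_newton:
  assumes "A \<subseteq> {1..n}" "i \<le> j"
  shows "of_int ((int (card A) - j) * i) * (esym X A i * esym X A j)
       - of_int ((int (card A) - i + 1) * (j + 1)) * (esym X A (i - 1) * esym X A (j + 1)) \<in> S n"
    (is "?T \<in> S n")
proof -
  have fin: "finite A" using assms(1) finite_subset by blast
  define F where "F = (\<lambda>s t. (X s - X t) * (esym X (A - {s}) (i - 1) * esym X (A - {t}) j))"
  have sym: "F s t + F t s \<in> S n" if "s \<in> A" "t \<in> A" for s t
  proof (cases "s = t")
    case True
    then show ?thesis by (simp add: F_def S_0)
  next
    case False
    let ?e = "esym X (A - {s, t})"
    have rem: "esym X (A - {u}) k = ?e k + X v * ?e (k - 1)" if "{u, v} = {s, t}" for u v k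
    proof -
      have "A - {u} = insert v (A - {s, t})" "v \<notin> A - {s, t}"
        using that \<open>s \<in> A\<close> \<open>t \<in> A\<close> False by (auto simp: doubleton_eq_iff)
      then show ?thesis using fin by (simp add: esym_insert)
    qed
    have "{t, s} = {s, t}" by auto
    then have "F s t + F t s = (X s - X t) ^ 2 * (?e (i - 1) * ?e (j - 1) - ?e (i - 1 - 1) * ?e (j - 1 + 1))"
      using rem[of s t] rem[of t s] by (simp add: F_def algebra_simps power2_eq_square)
    also have "\<dots> \<in> S n"
      using assms that
      by (intro S_mult S_square poly_ring_diff poly_ring_X esym_log_concave) auto
    finally show ?thesis .
  qed
  have "(\<Sum>s\<in>A. \<Sum>t\<in>A. F s t) \<in> S n"
    using sym by (rule S_double_sum)
  also have "(\<Sum>s\<in>A. \<Sum>t\<in>A. F s t)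
      = (\<Sum>s\<in>A. X s * esym X (A - {s}) (i - 1)) * (\<Sum>t\<in>A. esym X (A - {t}) j)
      - (\<Sum>s\<in>A. esym X (A - {s}) (i - 1)) * (\<Sum>t\<in>A. X t * esym X (A - {t}) (j + 1 - 1))"
    unfolding F_def sum_product sum_subtractf[symmetric]
    by (intro sum.cong refl) (simp add: algebra_simps)
  also have "\<dots> = ?T"
    using fin by (simp only: sum_esym_remove sum_mult_esym_remove) (simp add: algebra_simps)
  finally show ?thesis .
qed

lemma E_eq_esym: "E n k = Cst (1 / real (n choose k)) * esym X {1..n} (int k)"
  by (simp add: E_def esym_def)

lemma E_in_S: "E n k \<in> S n"
  unfolding E_def by (intro S_mult S_sum S_prod S_X S_Cst) auto

lemma E_step:
  assumes "m \<le> l" "l + 2 \<le> n"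
  shows "E n (m + 1) * E n (l + 1) - E n m * E n (l + 2) \<in> S n"
proof -
  let ?e = "\<lambda>k :: nat. esym X {1..n} (int k)"
  \<comment> \<open>Both normalising factors of the difference arise from \<open>1 / c\<close> by absorption:
    \<open>(k + 1) (n choose (k + 1)) = (n - k) (n choose k)\<close> with \<open>k = m\<close> and with \<open>k = l + 1\<close>.\<close>
  define c where "c = real (n - l - 1) * real (n - m) * real (n choose m) * real (n choose (l + 1))"
  have pos: "n choose m > 0" "n choose (m + 1) > 0" "n choose (l + 1) > 0" "n choose (l + 2) > 0"
    using assms by auto
  have absorb: "real (Suc k) * real (n choose Suc k) = real (n - k) * real (n choose k)" for k
    using binomial_absorb_comp[of n k] binomial_absorption[of k n] by (metis of_nat_mult)
  have "c = real (n - l - 1) * real (m + 1) * (real (n choose (m + 1)) * real (n choose (l + 1)))"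
    using absorb[of m] by (simp add: c_def)
  then have c1: "real (n - l - 1) * real (m + 1) / c
      = 1 / real (n choose (m + 1)) * (1 / real (n choose (l + 1)))"
    using pos assms by simp
  have "c = real (n - m) * real (l + 2) * (real (n choose m) * real (n choose (l + 2)))"
    using absorb[of "l + 1"] by (simp add: c_def)
  then have c2: "real (n - m) * real (l + 2) / c
      = 1 / real (n choose m) * (1 / real (n choose (l + 2)))"
    using pos assms by simp
  have "of_int ((int n - int (l + 1)) * int (m + 1)) * (?e (m + 1) * ?e (l + 1))
      - of_int ((int n - int (m + 1) + 1) * (int (l + 1) + 1)) * (?e m * ?e (l + 2)) \<in> S n"
    using esym_newton[of "{1..n}" n "int (m + 1)" "int (l + 1)"] assms(1)
    by (simp add: algebra_simps)
  also have "of_int ((int n - int (l + 1)) * int (m + 1)) = Cst (real (n - l - 1) * real (m + 1))"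
    using assms by (simp add: of_nat_diff flip: Cst_of_int)
  also have "of_int ((int n - int (m + 1) + 1) * (int (l + 1) + 1)) = Cst (real (n - m) * real (l + 2))"
    using assms by (simp add: of_nat_diff flip: Cst_of_int)
  finally have "Cst (1 / c) * (Cst (real (n - l - 1) * real (m + 1)) * (?e (m + 1) * ?e (l + 1))
      - Cst (real (n - m) * real (l + 2)) * (?e m * ?e (l + 2))) \<in> S n"
    by (intro S_mult[OF S_Cst]) (auto simp: c_def)
  also have "Cst (1 / c) * (Cst (real (n - l - 1) * real (m + 1)) * (?e (m + 1) * ?e (l + 1))
      - Cst (real (n - m) * real (l + 2)) * (?e m * ?e (l + 2)))
    = Cst (real (n - l - 1) * real (m + 1) / c) * (?e (m + 1) * ?e (l + 1))
      - Cst (real (n - m) * real (l + 2) / c) * (?e m * ?e (l + 2))"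
    by (simp add: right_diff_distrib mult.assoc[symmetric] flip: Cst_mult)
  also have "\<dots> = E n (m + 1) * E n (l + 1) - E n m * E n (l + 2)"
    unfolding c1 c2 E_eq_esym Cst_mult by (simp add: mult_ac)
  finally show ?thesis .
qed

theorem theorem5:
  fixes n p q r :: nat
  assumes "n \<ge> 1" and "p \<ge> q" and "q \<ge> r"
  shows "P n p ^ (q - r) * P n r ^ (p - q) - P n q ^ (p - r) \<in> S n \<and>
         (p \<le> n \<longrightarrow> E n q ^ (p - r) - E n p ^ (q - r) * E n r ^ (p - q) \<in> S n)"
proof (intro conjI impI)
  show "P n p ^ (q - r) * P n r ^ (p - q) - P n q ^ (p - r) \<in> S n"
  proof (rule spread_power[of "\<lambda>f g. f - g \<in> S n" p "P n"])
    fix f g h assume "f - g \<in> S n" "g - h \<in> S n"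
    then show "f - h \<in> S n" using S_add[of "f - g" n "g - h"] by simp
  next
    fix f g k assume "f - g \<in> S n"
    then show "P n k * f - P n k * g \<in> S n"
      using S_mult[OF P_in_S] by (simp flip: right_diff_distrib)
  qed (use assms P_step in \<open>auto simp: S_0\<close>)
next
  assume "p \<le> n"
  show "E n q ^ (p - r) - E n p ^ (q - r) * E n r ^ (p - q) \<in> S n"
  proof (rule spread_power[of "\<lambda>f g. g - f \<in> S n" n "E n"])
    fix f g h assume "g - f \<in> S n" "h - g \<in> S n"
    then show "h - f \<in> S n" using S_add[of "g - f" n "h - g"] by simp
  next
    fix f g k assume "g - f \<in> S n"
    then show "E n k * g - E n k * f \<in> S n"
      using S_mult[OF E_in_S] by (simp flip: right_diff_distrib)
  qed (use assms E_step \<open>p \<le> n\<close> in \<open>auto simp: S_0\<close>)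
qed

end
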